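(* Let $X$ be an Archimedean pervasive pre-Riesz space and $(Y,i)$ a vector lattice cover of $X$. Then $X$ has the extension property (E) for projection bands, that is, for every projection band $B$ in $X$ there exists a projection band $J$ in $Y$ such that $B=\{x\in X: i(x)\in J\}$.
   Context: All vector spaces are real. An ordered vector space $X$ is a real vector space with a cone $X_+$ (closed under addition and multiplication by nonnegative scalars, $X_+\cap(-X_+)=\{0\}$), ordered by $x\le y$ iff $y-x\in X_+$. It is Archimedean if $nx\le y$ for all $n\in\mathbb N$ implies $x\le 0$. A linear subspace $D$ of an ordered vector space $Y$ is order dense in $Y$ if $y=\inf\{z\in D: y\le z\}$ for every $y\in Y$. An ordered vector space $X$ is a pre-Riesz space if there exist a vector lattice $Y$ and a bipositive linear map $i\colon X\to Y$ (i.e. $i(x)\ge 0$ iff $x\ge 0$) such that $i(X)$ is order dense in $Y$; then $(Y,i)$ is called a vector lattice cover of $X$. A pre-Riesz space $X$ is pervasive if for some (equivalently, every) vector lattice cover $(Y,i)$ of $X$, for every $y\in Y_+$ with $y\ne 0$ there is $x\in X$ with $0<i(x)\le y$. For $M\subseteq X$, $M^u$ is the set of upper bounds of $M$ in $X$. Elements $x,y\in X$ are disjoint, $x\perp y$, if $\{x+y,-x-y\}^u=\{x-y,-x+y\}^u$ (in a vector lattice this is the usual disjointness). The disjoint complement of $M\subseteq X$ is $M^{\mathrm{d}}=\{x\in X: x\perp y\text{ for all }y\in M\}$, and $M^{\mathrm{dd}}=(M^{\mathrm{d}})^{\mathrm{d}}$. A linear subspace $B$ is a band if $B^{\mathrm{dd}}=B$;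 a band $B$ is a projection band if $X=B\oplus B^{\mathrm{d}}$. The same definitions apply in $Y$. *)

theory Defs
  imports "HOL-Analysis.Analysis" "HOL-Library.Lub_Glb"
begin

class vector_lattice = ordered_real_vector + lattice

definition archimedean_ovs :: "'a::ordered_real_vector itself \<Rightarrow> bool" where
  "archimedean_ovs _ \<longleftrightarrow> (\<forall>x y :: 'a. (\<forall>n::nat. real n *\<^sub>R x \<le> y) \<longrightarrow> x \<le> 0)"

definition order_dense :: "'a::ordered_real_vector set \<Rightarrow> bool" where
  "order_dense D \<longleftrightarrow> subspace D \<and> (\<forall>y. isGlb UNIV {z \<in> D. y \<le> z} y)"

definition bipositive :: "('a::ordered_real_vector \<Rightarrow> 'b::ordered_real_vector) \<Rightarrow> bool" where
  "bipositive i \<longleftrightarrow> (\<forall>x. 0 \<le> i x \<longleftrightarrow> 0 \<le> x)"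

text \<open>
  HOL cannot quantify existentially over types, so ``X is a pre-Riesz space'' is not a predicate
  on the type X alone; it is expressed by exhibiting a cover \<open>i\<close> of X.  As a hypothesis this is no
  loss: a type variable occurring only in the hypotheses is implicitly existentially quantified.
\<close>

definition vector_lattice_cover :: "('a::ordered_real_vector \<Rightarrow> 'b::vector_lattice) \<Rightarrow> bool" where
  "vector_lattice_cover i \<longleftrightarrow> linear i \<and> bipositive i \<and> order_dense (range i)"

text \<open>
  The domain of \<open>j\<close> is pervasive iff some cover \<open>j\<close> satisfies the following predicate.
\<close>

definition pervasive_cover :: "('a::ordered_real_vector \<Rightarrow> 'b::vector_lattice) \<Rightarrow> bool" where
  "pervasive_cover j \<longleftrightarrow> vector_lattice_cover j \<and>
     (\<forall>y. 0 \<le> y \<and> y \<noteq> 0 \<longrightarrow> (\<exists>x. 0 < j x \<and> j x \<le> y))"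

definition disjoint_elems :: "'a::ordered_real_vector \<Rightarrow> 'a \<Rightarrow> bool" where
  "disjoint_elems x y \<longleftrightarrow> ubs UNIV {x + y, - x - y} = ubs UNIV {x - y, - x + y}"

definition disjoint_compl :: "'a::ordered_real_vector set \<Rightarrow> 'a set" where
  "disjoint_compl M = {x. \<forall>y\<in>M. disjoint_elems x y}"

definition band :: "'a::ordered_real_vector set \<Rightarrow> bool" where
  "band B \<longleftrightarrow> subspace B \<and> disjoint_compl (disjoint_compl B) = B"

definition is_direct_sum :: "'a::real_vector set \<Rightarrow> 'a set \<Rightarrow> bool" where
  "is_direct_sum A B \<longleftrightarrow>
     subspace A \<and> subspace B \<and> A \<inter> B = {0} \<and> (\<forall>x. \<exists>a\<in>A. \<exists>b\<in>B. x = a + b)"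

definition projection_band :: "'a::ordered_real_vector set \<Rightarrow> bool" where
  "projection_band B \<longleftrightarrow> band B \<and> is_direct_sum B (disjoint_compl B)"

end

theory Submission
  imports Defs "HOL-Library.Lattice_Algebras"
begin

text \<open>
  Let \<open>X = B \<oplus> C\<close> with \<open>C\<close> the disjoint complement of the projection band \<open>B\<close>.  A cover \<open>i\<close>
  preserves disjointness, because upper bounds in the cover are determined by upper bounds from
  the order dense image (\<open>vector_lattice_cover_disjoint_elems\<close>).  Hence the summands of a positive
  \<open>b + c\<close> are positive (\<open>disjoint_elems_add_nonneg\<close>), and for positive \<open>b \<in> B\<close> and \<open>c \<in> C\<close> the
  infimum of \<open>i b\<close> and \<open>i c\<close> is zero.

  Let \<open>J\<close> and \<open>K\<close> be the order ideals of the cover generated by \<open>i(B)\<close> and \<open>i(C)\<close>.  They are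
  disjoint by the last remark.  They span the cover: the image of \<open>i\<close> is majorizing, and if
  \<open>0 \<le> y \<le> i (b + c)\<close> with \<open>b \<in> B\<close> and \<open>c \<in> C\<close>, then \<open>inf y (i b)\<close> lies in \<open>J\<close> and
  \<open>y - inf y (i b) = sup 0 (y - i b)\<close> lies in \<open>K\<close>.  Two ideals in this position are each other's
  disjoint complements, so \<open>J\<close> is a projection band, and \<open>J\<close> meets the image of \<open>X\<close> exactly in
  \<open>i(B)\<close> because \<open>i\<close> carries the decomposition of \<open>X\<close> to that of the cover.
\<close>

section \<open>The modulus and disjointness in vector lattices\<close>

instance vector_lattice \<subseteq> lattice_ab_group_add ..

text \<open>The absolute value; the class \<open>vector_lattice\<close> does not carry the constant \<open>abs\<close>.\<close>

definition modulus :: "'a::vector_lattice \<Rightarrow> 'a" where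
  "modulus x = sup x (- x)"

lemma modulus_le_iff: "modulus x \<le> z \<longleftrightarrow> x \<le> z \<and> - x \<le> z"
  by (simp add: modulus_def)

lemma modulus_ge: "x \<le> modulus x" "- x \<le> modulus x"
  by (simp_all add: modulus_def)

lemma modulus_minus [simp]: "modulus (- x) = modulus x"
  by (simp add: modulus_def sup_commute)

lemma modulus_nonneg: "0 \<le> modulus x"
proof -
  have "x + - x \<le> modulus x + modulus x"
    by (rule add_mono) (rule modulus_ge)+
  then show ?thesis
    by simp
qed

lemma modulus_le_0D:
  assumes "modulus x \<le> 0"
  shows "x = 0"
  using assms by (intro order.antisym) (auto simp: modulus_le_iff)

lemma modulus_of_nonneg:
  assumes "0 \<le> x"
  shows "modulus x = x"
proof -
  have "- x \<le> x"
    using assms by (meson neg_le_0_iff_le order_trans)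
  then show ?thesis
    by (simp add: modulus_def sup_absorb1)
qed

lemma modulus_triangle: "modulus (x + y) \<le> modulus x + modulus y"
proof -
  have "- x + - y \<le> modulus x + modulus y"
    by (rule add_mono) (rule modulus_ge)+
  then show ?thesis
    by (auto simp: modulus_le_iff intro: add_mono modulus_ge)
qed

lemma modulus_scaleR_le: "modulus (r *\<^sub>R y) \<le> \<bar>r\<bar> *\<^sub>R modulus y"
proof (cases "0 \<le> r")
  case True
  then show ?thesis
    using scaleR_left_mono [OF modulus_ge(1) True, of y]
      scaleR_left_mono [OF modulus_ge(2) True, of y]
    by (simp add: modulus_le_iff)
next
  case False
  then have r: "0 \<le> - r"
    by simp
  then show ?thesis
    using scaleR_left_mono [OF modulus_ge(1) r, of y]
      scaleR_left_mono [OF modulus_ge(2) r, of y] False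
    by (simp add: modulus_le_iff)
qed

lemma modulus_diff: "modulus (a - b) = sup a b - inf a b"
proof -
  have "sup a b - inf a b = sup a b + sup (- a) (- b)"
    by (rule diff_inf_eq_sup)
  also have "\<dots> = sup (sup a b - a) (sup a b - b)"
    by (simp add: add_sup_distrib_left)
  also have "\<dots> = sup (sup 0 (b - a)) (sup (a - b) 0)"
    using add_sup_distrib_right [of a b "- a"] add_sup_distrib_right [of a b "- b"] by simp
  also have "\<dots> = sup 0 (modulus (a - b))"
    by (simp add: modulus_def ac_simps)
  also have "\<dots> = modulus (a - b)"
    by (simp add: modulus_nonneg sup_absorb2)
  finally show ?thesis ..
qed

lemma disjoint_elems_commute: "disjoint_elems x y \<Longrightarrow> disjoint_elems y x"
  using minus_diff_commute [of x y] by (simp add: disjoint_elems_def add.commute insert_commute)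

lemma disjoint_elems_iff_modulus:
  fixes x y :: "'a::vector_lattice"
  shows "disjoint_elems x y \<longleftrightarrow> modulus (x + y) = modulus (x - y)"
proof -
  have "ubs UNIV {x + y, - x - y} = {modulus (x + y)..}"
    by (auto simp: ubs_def isUb_def setle_def modulus_le_iff)
  moreover have "ubs UNIV {x - y, - x + y} = {modulus (x - y)..}"
    by (auto simp: ubs_def isUb_def setle_def modulus_le_iff)
  ultimately show ?thesis
    by (metis disjoint_elems_def atLeast_eq_iff)
qed

lemma disjoint_elems_nonneg_inf:
  fixes a b :: "'a::vector_lattice"
  assumes "0 \<le> a" "0 \<le> b" "disjoint_elems a b"
  shows "inf a b = 0"
proof -
  have "a + b = modulus (a - b)"
    using assms by (metis disjoint_elems_iff_modulus modulus_of_nonneg add_nonneg_nonneg)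
  then have "sup a b + inf a b = sup a b - inf a b"
    using modulus_diff [of a b] add_eq_inf_sup [of a b] by simp
  then have "inf a b + inf a b = 0"
    by (simp only: diff_conv_add_uminus add_left_cancel eq_neg_iff_add_eq_0)
  then show ?thesis
    by simp
qed

lemma modulus_add_of_inf_zero:
  assumes "inf (modulus u) (modulus w) = 0"
  shows "modulus (u + w) = modulus u + modulus w"
proof (rule order.antisym)
  show "modulus (u + w) \<le> modulus u + modulus w"
    by (rule modulus_triangle)
  have "modulus u + modulus w = modulus (modulus u - modulus w)"
    using assms by (simp add: modulus_diff add_eq_inf_sup [of "modulus u"])
  also have "\<dots> \<le> modulus (u + w)"
    using modulus_triangle [of "u + w" "- w"] modulus_triangle [of "u + w" "- u"]
    by (simp add: modulus_le_iff algebra_simps)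
  finally show "modulus u + modulus w \<le> modulus (u + w)" .
qed

text \<open>
  If \<open>J\<close> and a subspace \<open>K\<close> are disjoint and together span the vector lattice, then \<open>J\<close> is all of
  the disjoint complement of \<open>K\<close>: if \<open>u + w\<close> is disjoint from \<open>w\<close>, where \<open>u \<in> J\<close> and \<open>w \<in> K\<close>, then \<open>u + 2 w\<close> and \<open>u\<close> have the
  same modulus, and so \<open>w = 0\<close>.
\<close>

lemma disjoint_compl_eq_of_disjoint_sum:
  fixes J K :: "'a::vector_lattice set"
  assumes K: "subspace K"
    and inf: "\<And>u w. u \<in> J \<Longrightarrow> w \<in> K \<Longrightarrow> inf (modulus u) (modulus w) = 0"
    and sum: "\<And>y. \<exists>u\<in>J. \<exists>w\<in>K. y = u + w"
  shows "disjoint_compl K = J"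
proof (intro equalityI subsetI)
  fix u assume "u \<in> J"
  have "modulus (u + w) = modulus (u - w)" if "w \<in> K" for w
    using modulus_add_of_inf_zero [of u w] modulus_add_of_inf_zero [of u "- w"]
      inf [OF \<open>u \<in> J\<close> that] by simp
  then show "u \<in> disjoint_compl K"
    by (simp add: disjoint_compl_def disjoint_elems_iff_modulus)
next
  fix y assume y: "y \<in> disjoint_compl K"
  obtain u w where uw: "u \<in> J" "w \<in> K" "y = u + w"
    using sum by blast
  have "w + w \<in> K"
    using K uw(2) by (simp add: subspace_add)
  have "modulus (u + w + w) = modulus u"
    using y uw by (auto simp: disjoint_compl_def disjoint_elems_iff_modulus)
  moreover have "modulus (u + (w + w)) = modulus u + modulus (w + w)"
    by (intro modulus_add_of_inf_zero inf uw \<open>w + w \<in> K\<close>)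
  ultimately have "modulus (w + w) = 0"
    by (simp add: add.assoc)
  then have "w + w = 0"
    by (intro modulus_le_0D) simp
  then show "y \<in> J"
    using uw by simp
qed

lemma projection_band_of_disjoint_sum:
  fixes J K :: "'a::vector_lattice set"
  assumes J: "subspace J" and K: "subspace K"
    and inf: "\<And>u w. u \<in> J \<Longrightarrow> w \<in> K \<Longrightarrow> inf (modulus u) (modulus w) = 0"
    and sum: "\<And>y. \<exists>u\<in>J. \<exists>w\<in>K. y = u + w"
  shows "projection_band J"
proof -
  have KJ: "disjoint_compl K = J"
    using K inf sum by (rule disjoint_compl_eq_of_disjoint_sum)
  have JK: "disjoint_compl J = K"
  proof (rule disjoint_compl_eq_of_disjoint_sum [OF J])
    show "inf (modulus w) (modulus u) = 0" if "w \<in> K" "u \<in> J" for w u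
      using inf [OF that(2,1)] by (simp add: inf_commute)
    show "\<exists>w\<in>K. \<exists>u\<in>J. y = w + u" for y
      using sum [of y] by (metis add.commute)
  qed
  have "J \<inter> K = {0}"
  proof (intro equalityI subsetI)
    fix y assume "y \<in> J \<inter> K"
    then have "inf (modulus y) (modulus y) = 0"
      by (intro inf) auto
    then show "y \<in> {0}"
      using modulus_le_0D [of y] by simp
  qed (use J K in \<open>simp add: subspace_0\<close>)
  then show ?thesis
    using J K sum by (simp add: projection_band_def band_def is_direct_sum_def KJ JK)
qed

section \<open>Vector lattice covers\<close>

lemma vector_lattice_cover_linear: "vector_lattice_cover i \<Longrightarrow> linear i"
  by (simp add: vector_lattice_cover_def)

lemma vector_lattice_cover_le_iff:
  assumes "vector_lattice_cover i"
  shows "i x \<le> i y \<longleftrightarrow> x \<le> y"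
proof -
  have "0 \<le> i (y - x) \<longleftrightarrow> 0 \<le> y - x"
    using assms by (auto simp: vector_lattice_cover_def bipositive_def)
  then show ?thesis
    by (simp add: linear_diff [OF vector_lattice_cover_linear [OF assms]])
qed

lemma vector_lattice_cover_nonneg_iff:
  assumes "vector_lattice_cover i"
  shows "0 \<le> i x \<longleftrightarrow> 0 \<le> x"
  using assms by (auto simp: vector_lattice_cover_def bipositive_def)

lemma order_dense_le_iff:
  assumes "order_dense D"
  shows "s \<le> y \<longleftrightarrow> (\<forall>z\<in>D. y \<le> z \<longrightarrow> s \<le> z)"
proof -
  have "isGlb UNIV {z \<in> D. y \<le> z} y"
    using assms by (simp add: order_dense_def)
  then show ?thesis
    by (auto simp: isGlb_def isLb_def greatestP_def setge_def setle_def intro: order_trans)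
qed

text \<open>
  An order dense subspace is majorizing: an element without upper bounds in \<open>D\<close> is the infimum of
  the empty set, hence the greatest element of the space, which forces the space to be trivial.
\<close>

lemma order_dense_majorizing:
  assumes "order_dense D"
  shows "\<exists>z\<in>D. y \<le> z"
proof (rule ccontr)
  assume no: "\<not> (\<exists>z\<in>D. y \<le> z)"
  have top: "s \<le> y" for s
    using no order_dense_le_iff [OF assms] by blast
  have "y + y \<le> y"
    by (rule top)
  then have "y \<le> 0"
    by simp
  moreover have "0 \<in> D"
    using assms by (simp add: order_dense_def subspace_0)
  ultimately show False
    using no by blast
qed

lemma vector_lattice_cover_disjoint_elems:
  assumes i: "vector_lattice_cover i" and "disjoint_elems x y"
  shows "disjoint_elems (i x) (i y)"
proof -
  note lin = vector_lattice_cover_linear [OF i]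
  have dense: "order_dense (range i)"
    using i by (simp add: vector_lattice_cover_def)
  have eq: "x + y \<le> z \<and> - (x + y) \<le> z \<longleftrightarrow> x - y \<le> z \<and> - (x - y) \<le> z" for z
    using assms(2) by (auto simp: disjoint_elems_def ubs_def isUb_def setle_def set_eq_iff)
  have bound: "modulus (i x + i y) \<le> i z \<longleftrightarrow> modulus (i x - i y) \<le> i z" for z
    by (simp only: modulus_le_iff linear_add [OF lin, symmetric] linear_diff [OF lin, symmetric]
        linear_neg [OF lin, symmetric] vector_lattice_cover_le_iff [OF i] eq)
  have below: "s \<le> modulus (i x + i y) \<longleftrightarrow> s \<le> modulus (i x - i y)" for s
    using order_dense_le_iff [OF dense, of s "modulus (i x + i y)"]
      order_dense_le_iff [OF dense, of s "modulus (i x - i y)"] bound by blast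
  have "modulus (i x + i y) = modulus (i x - i y)"
    using below [of "modulus (i x + i y)"] below [of "modulus (i x - i y)"]
    by (intro order.antisym) simp_all
  then show ?thesis
    by (simp add: disjoint_elems_iff_modulus)
qed

lemma disjoint_elems_add_nonneg:
  fixes i :: "'a::ordered_real_vector \<Rightarrow> 'b::vector_lattice" and b c :: 'a
  assumes i: "vector_lattice_cover i"
    and disj: "disjoint_elems b c" and nonneg: "0 \<le> b + c"
  shows "0 \<le> b" "0 \<le> c"
proof -
  have "0 \<le> i b + i c"
    using nonneg vector_lattice_cover_nonneg_iff [OF i, of "b + c"]
    by (simp add: linear_add [OF vector_lattice_cover_linear [OF i]])
  then have "i b + i c = modulus (i b - i c)"
    using vector_lattice_cover_disjoint_elems [OF i disj]
    by (metis disjoint_elems_iff_modulus modulus_of_nonneg)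
  then have "i b - i c \<le> i b + i c" "- (i b - i c) \<le> i b + i c"
    using modulus_ge [of "i b - i c"] by simp_all
  then have "0 \<le> i c + i c" "0 \<le> i b + i b"
    by (simp_all add: algebra_simps)
  then show "0 \<le> b" "0 \<le> c"
    by (simp_all add: vector_lattice_cover_nonneg_iff [OF i])
qed

section \<open>Extension of projection bands\<close>

text \<open>
  The elements whose modulus lies below a single element of \<open>i(B)\<close>.  For a subspace \<open>B\<close> they form
  an order ideal, which contains \<open>i(B)\<close>, and hence is generated by it, when \<open>B\<close> is directed.
\<close>

definition generated_ideal :: "('a \<Rightarrow> 'b::vector_lattice) \<Rightarrow> 'a set \<Rightarrow> 'b set" where
  "generated_ideal i B = {y. \<exists>b\<in>B. modulus y \<le> i b}"

lemma generated_idealI: "b \<in> B \<Longrightarrow> y \<le> i b \<Longrightarrow> - y \<le> i b \<Longrightarrow> y \<in> generated_ideal i B"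
  by (auto simp: generated_ideal_def modulus_le_iff)

lemma subspace_generated_ideal:
  assumes "linear i" "subspace B"
  shows "subspace (generated_ideal i B)"
proof (rule subspaceI)
  show "0 \<in> generated_ideal i B"
    using assms by (intro generated_idealI [of 0]) (auto simp: subspace_0 linear_0)
next
  fix x y assume "x \<in> generated_ideal i B" "y \<in> generated_ideal i B"
  then obtain b b' where "b \<in> B" "b' \<in> B" "modulus x \<le> i b" "modulus y \<le> i b'"
    by (auto simp: generated_ideal_def)
  moreover from this have "modulus (x + y) \<le> i (b + b')"
    using order_trans [OF modulus_triangle add_mono] by (simp add: linear_add [OF assms(1)])
  ultimately show "x + y \<in> generated_ideal i B"
    using assms(2) by (auto simp: generated_ideal_def intro: subspace_add)
next
  fix r :: real and y assume "y \<in> generated_ideal i B"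
  then obtain b where b: "b \<in> B" "modulus y \<le> i b"
    by (auto simp: generated_ideal_def)
  have "modulus (r *\<^sub>R y) \<le> \<bar>r\<bar> *\<^sub>R i b"
    by (rule order_trans [OF modulus_scaleR_le scaleR_left_mono]) (use b in auto)
  then have "modulus (r *\<^sub>R y) \<le> i (\<bar>r\<bar> *\<^sub>R b)"
    by (simp add: linear_scale [OF assms(1)])
  then show "r *\<^sub>R y \<in> generated_ideal i B"
    using b(1) assms(2) by (auto simp: generated_ideal_def intro: subspace_scale)
qed

lemma generated_ideals_inf_zero:
  assumes i: "vector_lattice_cover i"
    and disj: "\<And>b c. b \<in> B \<Longrightarrow> c \<in> C \<Longrightarrow> disjoint_elems b c"
    and u: "u \<in> generated_ideal i B" and w: "w \<in> generated_ideal i C"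
  shows "inf (modulus u) (modulus w) = 0"
proof -
  obtain b c where bc: "b \<in> B" "modulus u \<le> i b" "c \<in> C" "modulus w \<le> i c"
    using u w by (auto simp: generated_ideal_def)
  have "0 \<le> i b" "0 \<le> i c"
    using bc modulus_nonneg order_trans by blast+
  then have "inf (i b) (i c) = 0"
    by (intro disjoint_elems_nonneg_inf vector_lattice_cover_disjoint_elems [OF i] disj bc)
  then have "inf (modulus u) (modulus w) \<le> 0"
    using inf_mono [OF bc(2,4)] by simp
  then show ?thesis
    by (intro order.antisym) (auto simp: modulus_nonneg)
qed

lemma generated_ideals_span:
  assumes i: "vector_lattice_cover i" and B: "subspace B" and C: "subspace C"
    and disj: "\<And>b c. b \<in> B \<Longrightarrow> c \<in> C \<Longrightarrow> disjoint_elems b c"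
    and sum: "\<And>x. \<exists>b\<in>B. \<exists>c\<in>C. x = b + c"
  shows "\<exists>u\<in>generated_ideal i B. \<exists>w\<in>generated_ideal i C. y = u + w"
proof -
  note lin = vector_lattice_cover_linear [OF i]
  note subB = subspace_generated_ideal [OF lin B] and subC = subspace_generated_ideal [OF lin C]
  have nonneg: "\<exists>u\<in>generated_ideal i B. \<exists>w\<in>generated_ideal i C. y = u + w" if y: "0 \<le> y" for y
  proof -
    obtain x where x: "y \<le> i x"
      using order_dense_majorizing [of "range i" y] i by (auto simp: vector_lattice_cover_def)
    obtain b c where bc: "b \<in> B" "c \<in> C" "x = b + c"
      using sum by blast
    have "0 \<le> x"
      using order_trans [OF y x] by (simp add: vector_lattice_cover_nonneg_iff [OF i])
    then have "0 \<le> b" "0 \<le> c"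
      using disjoint_elems_add_nonneg [OF i disj [OF bc(1,2)]] bc(3) by auto
    then have pos: "0 \<le> i b" "0 \<le> i c"
      by (simp_all add: vector_lattice_cover_nonneg_iff [OF i])
    have "modulus (inf y (i b)) \<le> i b"
      using y pos by (simp add: modulus_of_nonneg)
    then have "inf y (i b) \<in> generated_ideal i B"
      using bc by (auto simp: generated_ideal_def)
    moreover have "y - inf y (i b) \<in> generated_ideal i C"
    proof -
      have "y - inf y (i b) = sup 0 (y - i b)"
        by (simp add: diff_inf_eq_sup add_sup_distrib_left)
      moreover have "sup 0 (y - i b) \<le> i c"
        using x pos bc(3) by (simp add: linear_add [OF lin] algebra_simps)
      ultimately have "modulus (y - inf y (i b)) \<le> i c"
        by (simp add: modulus_of_nonneg)
      then show ?thesis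
        using bc by (auto simp: generated_ideal_def)
    qed
    ultimately show ?thesis
      by (metis add.commute diff_add_cancel)
  qed
  obtain u w where uw: "u \<in> generated_ideal i B" "w \<in> generated_ideal i C" "pprt y = u + w"
    using nonneg [OF zero_le_pprt] by blast
  obtain u' w' where uw': "u' \<in> generated_ideal i B" "w' \<in> generated_ideal i C"
    "pprt (- y) = u' + w'"
    using nonneg [OF zero_le_pprt] by blast
  have "y = pprt y - pprt (- y)"
    unfolding pprt_neg diff_minus_eq_add by (rule prts)
  then have "y = (u - u') + (w - w')"
    unfolding uw(3) uw'(3) by (simp add: algebra_simps)
  moreover have "u - u' \<in> generated_ideal i B" "w - w' \<in> generated_ideal i C"
    using uw uw' subB subC by (auto intro: subspace_diff)
  ultimately show ?thesis
    by blast
qed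

text \<open>
  The summand \<open>B\<close> inherits directedness from \<open>X\<close>: the component in \<open>B\<close> of an upper bound of \<open>x\<close>
  and \<open>- x\<close>, for \<open>x \<in> B\<close>, is again such an upper bound.
\<close>

lemma image_in_generated_ideal:
  assumes i: "vector_lattice_cover i" and B: "subspace B"
    and disj: "\<And>b c. b \<in> B \<Longrightarrow> c \<in> C \<Longrightarrow> disjoint_elems b c"
    and sum: "\<And>x. \<exists>b\<in>B. \<exists>c\<in>C. x = b + c"
    and x: "x \<in> B"
  shows "i x \<in> generated_ideal i B"
proof -
  note neg = linear_neg [OF vector_lattice_cover_linear [OF i]]
  obtain z where z: "modulus (i x) \<le> i z"
    using order_dense_majorizing [of "range i"] i by (auto simp: vector_lattice_cover_def)
  obtain b c where bc: "b \<in> B" "c \<in> C" "z = b + c"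
    using sum by blast
  have "i x \<le> i z" "i (- x) \<le> i z"
    using z by (simp_all add: modulus_le_iff neg)
  then have "x \<le> z" "- x \<le> z"
    by (simp_all only: vector_lattice_cover_le_iff [OF i])
  then have "0 \<le> (b - x) + c" "0 \<le> (b + x) + c"
    using bc(3) diff_ge_0_iff_ge [of z x] diff_ge_0_iff_ge [of z "- x"]
    by (simp_all only: diff_conv_add_uminus minus_minus ac_simps)
  moreover have "b - x \<in> B" "b + x \<in> B"
    using B bc x by (auto intro: subspace_diff subspace_add)
  ultimately have "0 \<le> b - x" "0 \<le> b + x"
    using disjoint_elems_add_nonneg(1) [OF i disj] bc(2) by blast+
  then have "x \<le> b" "- x \<le> b"
    using diff_ge_0_iff_ge [of b "- x"] by simp_all
  then have "i x \<le> i b" "i (- x) \<le> i b"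
    by (simp_all only: vector_lattice_cover_le_iff [OF i])
  then show ?thesis
    using bc(1) by (intro generated_idealI) (auto simp: neg)
qed

lemma image_in_generated_ideal_iff:
  assumes i: "vector_lattice_cover i" and B: "subspace B" and C: "subspace C"
    and disj: "\<And>b c. b \<in> B \<Longrightarrow> c \<in> C \<Longrightarrow> disjoint_elems b c"
    and sum: "\<And>x. \<exists>b\<in>B. \<exists>c\<in>C. x = b + c"
  shows "i x \<in> generated_ideal i B \<longleftrightarrow> x \<in> B"
proof
  assume "x \<in> B"
  with i B disj sum show "i x \<in> generated_ideal i B"
    by (rule image_in_generated_ideal)
next
  assume ix: "i x \<in> generated_ideal i B"
  note lin = vector_lattice_cover_linear [OF i]
  obtain b c where bc: "b \<in> B" "c \<in> C" "x = b + c"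
    using sum by blast
  have "i b \<in> generated_ideal i B"
    using i B disj sum bc(1) by (rule image_in_generated_ideal)
  then have "i x - i b \<in> generated_ideal i B"
    by (intro subspace_diff subspace_generated_ideal lin B ix)
  then have icB: "i c \<in> generated_ideal i B"
    using bc(3) by (simp add: linear_add [OF lin])
  have icC: "i c \<in> generated_ideal i C"
  proof (rule image_in_generated_ideal [OF i C _ _ bc(2)])
    show "disjoint_elems c' b'" if "c' \<in> C" "b' \<in> B" for c' b'
      using disj [OF that(2,1)] by (rule disjoint_elems_commute)
    show "\<exists>c\<in>C. \<exists>b\<in>B. z = c + b" for z
      using sum [of z] by (metis add.commute)
  qed
  have "inf (modulus (i c)) (modulus (i c)) = 0"
    by (rule generated_ideals_inf_zero [OF i disj icB icC])
  then have "i c = i 0"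
    using modulus_le_0D [of "i c"] by (simp add: linear_0 [OF lin])
  then have "c = 0"
    using vector_lattice_cover_le_iff [OF i, of c 0] vector_lattice_cover_le_iff [OF i, of 0 c]
    by simp
  then show "x \<in> B"
    using bc by simp
qed

theorem corollary22:
  fixes i :: "'x::ordered_real_vector \<Rightarrow> 'y::vector_lattice"
    and j :: "'x \<Rightarrow> 'z::vector_lattice"
  assumes "archimedean_ovs TYPE('x)"
    and "pervasive_cover j"
    and "vector_lattice_cover i"
  shows "\<forall>B::'x set. projection_band B \<longrightarrow>
           (\<exists>J::'y set. projection_band J \<and> B = {x. i x \<in> J})"
proof (intro allI impI)
  fix B :: "'x set"
  assume "projection_band B"
  note i = assms(3)
  define C where "C = disjoint_compl B"
  have B: "subspace B" and C: "subspace C"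
    and sum: "\<And>x. \<exists>b\<in>B. \<exists>c\<in>C. x = b + c"
    using \<open>projection_band B\<close> by (auto simp: projection_band_def is_direct_sum_def C_def)
  have disj: "disjoint_elems b c" if "b \<in> B" "c \<in> C" for b c
    using that by (auto simp: C_def disjoint_compl_def intro: disjoint_elems_commute)
  note lin = vector_lattice_cover_linear [OF i]
  have "projection_band (generated_ideal i B)"
    using subspace_generated_ideal [OF lin B] subspace_generated_ideal [OF lin C]
      generated_ideals_inf_zero [OF i disj] generated_ideals_span [OF i B C disj sum]
    by (rule projection_band_of_disjoint_sum)
  moreover have "B = {x. i x \<in> generated_ideal i B}"
    using image_in_generated_ideal_iff [OF i B C disj sum] by blast
  ultimately show "\<exists>J::'y set. projection_band J \<and> B = {x. i x \<in> J}"
    by blast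
qed

end
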